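(* Fix $t>0$, $x_0\in\mathbb{R}$, $\mu\in\mathbb{R}$ and $\theta>0$. For $\sigma^2>0$ (with $\sigma>0$) let $\gamma_{\sigma^2}$ be the Gaussian probability measure on $\mathbb{R}$ with mean $m_t=x_0e^{-\theta t}+\mu(1-e^{-\theta t})$ and variance $\sigma_t^2=\frac{\sigma^2}{2\theta}\left(1-e^{-2\theta t}\right)$. For $n\in\mathbb{N}$ define $T_n^{***}:\mathbb{R}^n\to\mathbb{R}$ by $$T_n^{***}(z_1,\dots,z_n)=\frac{2\theta\sum_{k=1}^n\left(z_k-x_0e^{-\theta t}-\mu(1-e^{-\theta t})\right)^2}{n\left(1-e^{-2\theta t}\right)}.$$ Then the estimators $T_{***}^{(0)}:\mathbb{R}^{\infty}\to\mathbb{R}$ and $T_{***}^{(1)}:\mathbb{R}^{\infty}\to\mathbb{R}$ defined by $$T_{***}^{(0)}((z_k)_{k\in\mathbb{N}})=\liminf_{n\to\infty}T_n^{***}(z_1,\dots,z_n)\quad\text{and}\quad T_{***}^{(1)}((z_k)_{k\in\mathbb{N}})=\limsup_{n\to\infty}T_n^{***}(z_1,\dots,z_n)$$ are infinite-sample consistent estimators of the parameter $\sigma^2$ (the square of the degree of volatility $\sigma$) for the family of probability measures $(\gamma_{\sigma^2}^{\infty})_{\sigma^2>0}$.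
   Context: $\mathbb{R}^\infty=\mathbb{R}^{\mathbb{N}}$ is the space of real sequences $(z_k)_{k\in\mathbb{N}}$, $\mathbb{N}=\{1,2,\dots\}$, with its Borel $\sigma$-algebra; for a Borel probability measure $\gamma$ on $\mathbb{R}$, $\gamma^{\infty}$ denotes the infinite product measure $\gamma\times\gamma\times\cdots$ on $\mathbb{R}^\infty$. Given a family $(\gamma_\vartheta)_{\vartheta\in\Theta}$ of Borel probability measures on $\mathbb{R}$ with $\Theta\subseteq\mathbb{R}$, a Borel measurable function $T:\mathbb{R}^\infty\to\mathbb{R}$ is called an infinite-sample consistent estimator of the parameter $\vartheta$ for the family $(\gamma_\vartheta^\infty)_{\vartheta\in\Theta}$ if $\gamma_\vartheta^\infty(\{(z_k)_{k\in\mathbb{N}}\in\mathbb{R}^\infty: T((z_k)_{k\in\mathbb{N}})=\vartheta\})=1$ for every $\vartheta\in\Theta$. (The measure $\gamma_{\sigma^2}$ is the law at time $t$ of the Ornstein-Uhlenbeck process $x_t=x_0e^{-\theta t}+\mu(1-e^{-\theta t})+\sigma\int_0^te^{-\theta(t-s)}dW_s$ with $W$ a Wiener process; the claim only uses $\gamma_{\sigma^2}$ as defined in it.) *)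

theory Defs
  imports "HOL-Probability.Probability"
begin

text \<open>
  Points of \<open>\<real>\<^sup>\<infinity>\<close> are functions of type \<^typ>\<open>nat \<Rightarrow> real\<close>, indexed from 0: the coordinate
  \<open>z\<^sub>k\<close>, \<open>k = 1, 2, \<dots>\<close>, is \<open>z (k - 1)\<close>.  The Borel sigma-algebra on this type is the one of the
  product topology; by the library fact \<open>sets_PiM_equal_borel\<close> it is the sigma-algebra of the product measure below.
\<close>

definition infinite_power :: "real measure \<Rightarrow> (nat \<Rightarrow> real) measure" where
  "infinite_power \<gamma> = Pi\<^sub>M UNIV (\<lambda>_. \<gamma>)"

definition infinite_sample_consistent ::
    "real set \<Rightarrow> (real \<Rightarrow> real measure) \<Rightarrow> ((nat \<Rightarrow> real) \<Rightarrow> real) \<Rightarrow> bool" where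
  "infinite_sample_consistent \<Theta> \<gamma> T \<longleftrightarrow>
     (\<forall>p\<in>\<Theta>. real_distribution (\<gamma> p)) \<and>
     T \<in> borel_measurable borel \<and>
     (\<forall>p\<in>\<Theta>. emeasure (infinite_power (\<gamma> p)) {z. T z = p} = 1)"

text \<open>\<^const>\<open>normal_density\<close> takes the standard deviation, not the variance.\<close>

definition gaussian :: "real \<Rightarrow> real \<Rightarrow> real measure" where
  "gaussian m v = density lborel (\<lambda>x. ennreal (normal_density m (sqrt v) x))"

definition ou_mean :: "real \<Rightarrow> real \<Rightarrow> real \<Rightarrow> real \<Rightarrow> real" where
  "ou_mean t x0 \<mu> \<theta> = x0 * exp (- \<theta> * t) + \<mu> * (1 - exp (- \<theta> * t))"

text \<open>The argument \<open>s2\<close> is the squared volatility \<open>\<sigma>\<^sup>2\<close>, the parameter to be estimated.\<close>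

definition ou_variance :: "real \<Rightarrow> real \<Rightarrow> real \<Rightarrow> real" where
  "ou_variance t \<theta> s2 = s2 / (2 * \<theta>) * (1 - exp (- 2 * \<theta> * t))"

definition ou_law :: "real \<Rightarrow> real \<Rightarrow> real \<Rightarrow> real \<Rightarrow> real \<Rightarrow> real measure" where
  "ou_law t x0 \<mu> \<theta> s2 = gaussian (ou_mean t x0 \<mu> \<theta>) (ou_variance t \<theta> s2)"

text \<open>Only the first \<open>n\<close> coordinates of \<open>z\<close> are used; the value at \<open>n = 0\<close> is irrelevant.\<close>

definition vol_estimator ::
    "real \<Rightarrow> real \<Rightarrow> real \<Rightarrow> real \<Rightarrow> nat \<Rightarrow> (nat \<Rightarrow> real) \<Rightarrow> real" where
  "vol_estimator t x0 \<mu> \<theta> n z =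
     2 * \<theta> * (\<Sum>k<n. (z k - x0 * exp (- \<theta> * t) - \<mu> * (1 - exp (- \<theta> * t)))\<^sup>2) /
       (real n * (1 - exp (- 2 * \<theta> * t)))"

text \<open>
  The lower and upper limits are formed in the extended reals.  To obtain real-valued functions,
  the value \<open>\<infinity>\<close> is replaced by 0, as \<^const>\<open>real_of_ereal\<close> does.  Since 0 is not an admissible
  parameter, consistency still entails that the limits are finite almost surely.
\<close>

definition vol_estimator_liminf ::
    "real \<Rightarrow> real \<Rightarrow> real \<Rightarrow> real \<Rightarrow> (nat \<Rightarrow> real) \<Rightarrow> real" where
  "vol_estimator_liminf t x0 \<mu> \<theta> z =
     real_of_ereal (liminf (\<lambda>n. ereal (vol_estimator t x0 \<mu> \<theta> n z)))"

definition vol_estimator_limsup ::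
    "real \<Rightarrow> real \<Rightarrow> real \<Rightarrow> real \<Rightarrow> (nat \<Rightarrow> real) \<Rightarrow> real" where
  "vol_estimator_limsup t x0 \<mu> \<theta> z =
     real_of_ereal (limsup (\<lambda>n. ereal (vol_estimator t x0 \<mu> \<theta> n z)))"

end

theory Submission imports Defs begin

text \<open>
  Since \<open>E (z\<^sub>k - m\<^sub>t)\<^sup>2 = \<sigma>\<^sub>t\<^sup>2 = \<sigma>\<^sup>2 (1 - exp (- 2 \<theta> t)) / (2 \<theta>)\<close>, the strong law of large numbers for the
  independent variables \<open>(z\<^sub>k - m\<^sub>t)\<^sup>2\<close> makes the estimators converge to \<open>\<sigma>\<^sup>2\<close> almost surely.  All
  moments being finite, the strong law follows from \<open>E S\<^sub>n\<^sup>4 = O(n\<^sup>2)\<close> for the centred partial sums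
  \<open>S\<^sub>n\<close>: the series of the \<open>(S\<^sub>n / n)\<^sup>4\<close> then has finite expectation, so it converges almost surely.
\<close>

section \<open>Fourth moments and the strong law for independent centred variables\<close>

lemma power_le_one_plus_power4:
  fixes a :: real
  assumes "k \<le> 4"
  shows "\<bar>a\<bar> ^ k \<le> 1 + a ^ 4"
proof (cases "\<bar>a\<bar> \<le> 1")
  case True
  then have "\<bar>a\<bar> ^ k \<le> 1" by (simp add: power_le_one)
  then show ?thesis by (simp add: add_increasing2)
next
  case False
  then have "\<bar>a\<bar> ^ k \<le> \<bar>a\<bar> ^ 4" using assms by (intro power_increasing) auto
  then show ?thesis by simp
qed

lemma (in finite_measure) integrable_power_of_power4:
  fixes X :: "'a \<Rightarrow> real"
  assumes [measurable]: "X \<in> borel_measurable M" and int: "integrable M (\<lambda>x. X x ^ 4)" and "k \<le> 4"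
  shows "integrable M (\<lambda>x. X x ^ k)"
proof (rule Bochner_Integration.integrable_bound)
  show "integrable M (\<lambda>x. 1 + X x ^ 4)" using int by simp
  show "AE x in M. norm (X x ^ k) \<le> norm (1 + X x ^ 4)"
    using power_le_one_plus_power4[OF \<open>k \<le> 4\<close>] by (auto simp: power_abs add_nonneg_nonneg)
qed simp

text \<open>Independence factorizes every mixed moment, so each binomial term with a factor of
  exponent 1 has expectation 0. The conclusions together form the induction step for partial
  sums.\<close>

lemma (in prob_space) indep_centered_sum_power4_step:
  fixes S Y :: "'a \<Rightarrow> real"
  assumes indep: "indep_var borel Y borel S"
    and intS: "integrable M (\<lambda>x. S x ^ 4)" and intY: "integrable M (\<lambda>x. Y x ^ 4)"
    and ES: "expectation S = 0" and EY: "expectation Y = 0"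
  shows "integrable M (\<lambda>x. (Y x + S x) ^ 4)"
    and "expectation (\<lambda>x. Y x + S x) = 0"
    and "expectation (\<lambda>x. (Y x + S x)\<^sup>2) = expectation (\<lambda>x. (Y x)\<^sup>2) + expectation (\<lambda>x. (S x)\<^sup>2)"
    and "expectation (\<lambda>x. (Y x + S x) ^ 4) = expectation (\<lambda>x. Y x ^ 4)
           + 6 * (expectation (\<lambda>x. (Y x)\<^sup>2) * expectation (\<lambda>x. (S x)\<^sup>2)) + expectation (\<lambda>x. S x ^ 4)"
proof -
  have [measurable]: "Y \<in> borel_measurable M" "S \<in> borel_measurable M"
    using indep by (auto dest: indep_var_rv1 indep_var_rv2)
  have Sk: "integrable M (\<lambda>x. S x ^ k)" and Yk: "integrable M (\<lambda>x. Y x ^ k)" if "k \<le> 4" for k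
    using that integrable_power_of_power4[OF _ intS] integrable_power_of_power4[OF _ intY] by simp_all
  have ind: "indep_var borel (\<lambda>x. Y x ^ i) borel (\<lambda>x. S x ^ j)" for i j
    using indep_var_compose[OF indep, of "\<lambda>y. y ^ i" borel "\<lambda>y. y ^ j" borel] by (simp add: comp_def)
  have prod: "integrable M (\<lambda>x. Y x ^ i * S x ^ j)"
      "expectation (\<lambda>x. Y x ^ i * S x ^ j) = expectation (\<lambda>x. Y x ^ i) * expectation (\<lambda>x. S x ^ j)"
    if "i \<le> 4" "j \<le> 4" for i j
    using that by (intro indep_var_integrable indep_var_lebesgue_integral ind Sk Yk; simp)+
  \<comment> \<open>The exponents 1 stay explicit so that every mixed term is an instance of
    \<open>prod\<close>.\<close>
  have sq: "(Y x + S x)\<^sup>2 = (Y x)\<^sup>2 + 2 * (Y x ^ 1 * S x ^ 1) + (S x)\<^sup>2" for x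
    by (simp add: power2_sum)
  have p4: "(Y x + S x) ^ 4 = Y x ^ 4 + 4 * (Y x ^ 3 * S x ^ 1) + 6 * (Y x ^ 2 * S x ^ 2)
      + 4 * (Y x ^ 1 * S x ^ 3) + S x ^ 4" for x
    by (simp add: eval_nat_numeral algebra_simps)
  show "integrable M (\<lambda>x. (Y x + S x) ^ 4)"
    unfolding p4 by (intro Bochner_Integration.integrable_add integrable_mult_right prod Sk Yk; simp)
  show "expectation (\<lambda>x. Y x + S x) = 0"
    using Sk[of 1] Yk[of 1] ES EY by simp
  show "expectation (\<lambda>x. (Y x + S x)\<^sup>2) = expectation (\<lambda>x. (Y x)\<^sup>2) + expectation (\<lambda>x. (S x)\<^sup>2)"
    unfolding sq using prod[of 1 1] Sk[of 2] Yk[of 2] ES EY by simp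
  show "expectation (\<lambda>x. (Y x + S x) ^ 4) = expectation (\<lambda>x. Y x ^ 4)
           + 6 * (expectation (\<lambda>x. (Y x)\<^sup>2) * expectation (\<lambda>x. (S x)\<^sup>2)) + expectation (\<lambda>x. S x ^ 4)"
    unfolding p4 using prod[of 3 1] prod[of 1 3] prod[of 2 2] Sk[of 4] Yk[of 4] ES EY by simp
qed

text \<open>The second moment of the partial sum grows at most linearly, so each new summand raises
  the fourth moment by O(n), which adds up to O(n^2). A uniform bound \<open>C\<close> replaces
  identical distribution.\<close>

lemma (in prob_space) indep_centered_sum_power4_bound:
  fixes X :: "nat \<Rightarrow> 'a \<Rightarrow> real"
  assumes indep: "indep_vars (\<lambda>_. borel) X UNIV"
    and E0: "\<And>i. expectation (X i) = 0"
    and int4: "\<And>i. integrable M (\<lambda>x. X i x ^ 4)"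
    and E4: "\<And>i. expectation (\<lambda>x. X i x ^ 4) \<le> C"
  shows "integrable M (\<lambda>x. (\<Sum>k<n. X k x) ^ 4)"
    and "expectation (\<lambda>x. (\<Sum>k<n. X k x) ^ 4) \<le> 3 * (1 + C)\<^sup>2 * (real n)\<^sup>2"
proof -
  \<comment> \<open>One constant serves both moments: a^2 \<le> 1 + a^4 bounds the second by
    \<open>D\<close>, and \<open>C\<close> \<le> \<open>D\<close> \<le> \<open>D\<close>^2 bounds
    the fourth since 1 \<le> \<open>D\<close>.\<close>
  define D where "D = 1 + C"
  have rv [measurable]: "X i \<in> borel_measurable M" for i
    using indep by (simp add: indep_vars_def)
  have "0 \<le> expectation (\<lambda>x. X 0 x ^ 4)" by simp
  then have D: "1 \<le> D" using E4[of 0] unfolding D_def by linarith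
  have E2: "expectation (\<lambda>x. (X i x)\<^sup>2) \<le> D" for i
  proof -
    have "integrable M (\<lambda>x. (X i x)\<^sup>2)"
      by (rule integrable_power_of_power4[OF rv int4]) simp
    then have "expectation (\<lambda>x. (X i x)\<^sup>2) \<le> expectation (\<lambda>x. 1 + X i x ^ 4)"
      using power_le_one_plus_power4[of 2] int4 by (intro integral_mono) auto
    also have "\<dots> \<le> D" using int4[of i] E4[of i] by (simp add: D_def prob_space)
    finally show ?thesis .
  qed
  let ?S = "\<lambda>n x. \<Sum>k<n. X k x"
  have "integrable M (\<lambda>x. ?S n x ^ 4) \<and> expectation (?S n) = 0 \<and>
      expectation (\<lambda>x. (?S n x)\<^sup>2) \<le> D * n \<and> expectation (\<lambda>x. ?S n x ^ 4) \<le> 3 * D\<^sup>2 * (real n)\<^sup>2"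
  proof (induction n)
    case 0
    then show ?case by simp
  next
    case (Suc n)
    have "indep_var borel (X n) borel (?S n)"
      by (intro indep_vars_sum indep_vars_subset[OF indep]) auto
    note step = indep_centered_sum_power4_step[OF this _ int4 _ E0]
    have eq: "?S (Suc n) = (\<lambda>x. X n x + ?S n x)" by (auto simp: add.commute)
    have "expectation (\<lambda>x. (X n x)\<^sup>2) * expectation (\<lambda>x. (?S n x)\<^sup>2) \<le> D * (D * n)"
      using Suc.IH E2[of n] D by (intro mult_mono) auto
    moreover have "expectation (\<lambda>x. X n x ^ 4) \<le> D\<^sup>2"
      using E4[of n] D self_le_power[of D 2] by (simp add: D_def)
    ultimately have "expectation (\<lambda>x. (X n x + ?S n x) ^ 4) \<le> D\<^sup>2 + 6 * (D * (D * n)) + 3 * D\<^sup>2 * (real n)\<^sup>2"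
      using Suc.IH step(4) by auto
    \<comment> \<open>The factor 3 is chosen so that 3 (n + 1)^2 = 3 n^2 + 6 n + 3 absorbs the cross
      term 6 n exactly.\<close>
    also have "\<dots> \<le> 3 * D\<^sup>2 * (real (Suc n))\<^sup>2"
      by (simp add: power2_eq_square algebra_simps)
    finally show ?case
      unfolding eq using Suc.IH step(1-3) E2[of n] by (auto simp: algebra_simps)
  qed
  then show "integrable M (\<lambda>x. ?S n x ^ 4)"
    "expectation (\<lambda>x. ?S n x ^ 4) \<le> 3 * (1 + C)\<^sup>2 * (real n)\<^sup>2"
    by (auto simp: D_def)
qed

text \<open>Second moments would only give E (S_n / n)^2 = O(1/n), which is not summable; fourth
  moments give O(1/n^2).\<close>

lemma (in prob_space) strong_law_of_large_numbers_power4: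
  fixes X :: "nat \<Rightarrow> 'a \<Rightarrow> real"
  assumes indep: "indep_vars (\<lambda>_. borel) X UNIV"
    and E0: "\<And>i. expectation (X i) = 0"
    and int4: "\<And>i. integrable M (\<lambda>x. X i x ^ 4)"
    and E4: "\<And>i. expectation (\<lambda>x. X i x ^ 4) \<le> C"
  shows "AE x in M. (\<lambda>n. (\<Sum>k<n. X k x) / real n) \<longlonglongrightarrow> 0"
proof -
  have rv [measurable]: "X i \<in> borel_measurable M" for i
    using indep by (simp add: indep_vars_def)
  let ?A = "\<lambda>n x. ((\<Sum>k<n. X k x) / real n) ^ 4"
  let ?K = "3 * (1 + C)\<^sup>2"
  note bound = indep_centered_sum_power4_bound[OF assms]
  have int: "integrable M (?A n)" for n
    using bound(1) by (simp add: power_divide)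
  have le: "expectation (?A n) \<le> ?K * inverse (real n ^ 2)" for n
  \<comment> \<open>At n = 0 both sides are 0, because division by zero yields 0.\<close>
  proof (cases "n = 0")
    case False
    have "expectation (?A n) \<le> ?K * (real n)\<^sup>2 / real n ^ 4"
      using bound(2)[of n] by (simp add: power_divide divide_right_mono)
    also have "\<dots> = ?K * inverse (real n ^ 2)"
      using False by (simp add: field_simps eval_nat_numeral)
    finally show ?thesis .
  qed simp
  have sum: "summable (\<lambda>n. expectation (?A n))"
  proof (rule summable_comparison_test')
    show "summable (\<lambda>n. ?K * inverse (real n ^ 2))"
      by (intro summable_mult inverse_power_summable) simp
    show "norm (expectation (?A n)) \<le> ?K * inverse (real n ^ 2)" if "n \<ge> 0" for n
      using le[of n] by simp
  qed
  \<comment> \<open>For nonnegative terms sum and integral commute in \<open>ennreal\<close>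
    unconditionally; finiteness of the result then forces the series to be finite almost
    everywhere.\<close>
  have "(\<integral>\<^sup>+x. (\<Sum>n. ennreal (?A n x)) \<partial>M) = (\<Sum>n. \<integral>\<^sup>+x. ennreal (?A n x) \<partial>M)"
    by (intro nn_integral_suminf) simp
  also have "\<dots> = (\<Sum>n. ennreal (expectation (?A n)))"
    using int by (subst nn_integral_eq_integral) auto
  also have "\<dots> \<noteq> \<infinity>"
    using sum by (subst suminf_ennreal2) auto
  finally have "AE x in M. (\<Sum>n. ennreal (?A n x)) \<noteq> \<infinity>"
    by (intro nn_integral_noteq_infinite) auto
  then show ?thesis
  proof eventually_elim
    case (elim x)
    then have "summable (\<lambda>n. ?A n x)"
      by (intro summable_suminf_not_top) auto
    \<comment> \<open>The fourth root undoes the power up to an absolute value, which is harmless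
      for the limit 0.\<close>
    then have "(\<lambda>n. root 4 (?A n x)) \<longlonglongrightarrow> root 4 0"
      by (intro tendsto_real_root summable_LIMSEQ_zero)
    moreover have "root 4 (a ^ 4) = \<bar>a\<bar>" for a :: real
      using real_root_power_cancel[of 4 "\<bar>a\<bar>"] by simp
    ultimately show ?case by (simp only: real_root_zero tendsto_rabs_zero_iff)
  qed
qed

section \<open>Gaussian moments and independent Gaussian samples\<close>

lemma real_distribution_gaussian:
  assumes "0 < v"
  shows "real_distribution (gaussian m v)"
proof -
  interpret prob_space "gaussian m v"
    unfolding gaussian_def using assms by (intro prob_space_normal_density) simp
  show ?thesis by unfold_locales (simp_all add: gaussian_def)
qed

lemma gaussian_square_moments:
  assumes "0 < v"
  shows "integral\<^sup>L (gaussian m v) (\<lambda>x. (x - m)\<^sup>2 - v) = 0"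
    and "integrable (gaussian m v) (\<lambda>x. ((x - m)\<^sup>2 - v) ^ 4)"
proof -
  interpret real_distribution "gaussian m v"
    using assms by (rule real_distribution_gaussian)
  have s: "0 < sqrt v" using assms by simp
  have int: "integrable (gaussian m v) (\<lambda>x. (x - m) ^ k)" for k
    unfolding gaussian_def using integrable_normal_moment[OF s, of m k]
    by (subst integrable_real_density) auto
  \<comment> \<open>The exponent 2 * 1 matches the formula for even central moments, which at index
    1 gives (\<open>sqrt v\<close>)^2 = \<open>v\<close>.\<close>
  have "integral\<^sup>L (gaussian m v) (\<lambda>x. (x - m)\<^sup>2)
      = integral\<^sup>L lborel (\<lambda>x. normal_density m (sqrt v) x * (x - m) ^ (2 * 1))"
    unfolding gaussian_def by (subst integral_real_density) simp_all
  also have "\<dots> = v"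
    unfolding integral_normal_moment_even[OF s] using assms by simp
  finally have "integral\<^sup>L (gaussian m v) (\<lambda>x. (x - m)\<^sup>2) = v" .
  then show "integral\<^sup>L (gaussian m v) (\<lambda>x. (x - m)\<^sup>2 - v) = 0"
    using int[of 2] prob_space by simp
  have eq: "((x - m)\<^sup>2 - v) ^ 4 = (x - m) ^ 8 - 4 * v * (x - m) ^ 6 + 6 * v\<^sup>2 * (x - m) ^ 4
      - 4 * v ^ 3 * (x - m)\<^sup>2 + v ^ 4" for x :: real
    by (simp add: eval_nat_numeral algebra_simps)
  show "integrable (gaussian m v) (\<lambda>x. ((x - m)\<^sup>2 - v) ^ 4)"
    unfolding eq by (intro Bochner_Integration.integrable_add Bochner_Integration.integrable_diff
      integrable_mult_right int) simp
qed

text \<open>Independence means that the joint law is the product of the marginals. The joint law of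
  the coordinates is the product measure itself, as restriction to \<open>I\<close> fixes every
  point of its space, and the marginals are the factors.\<close>

lemma indep_vars_PiM_coordinates:
  assumes "\<And>i. i \<in> I \<Longrightarrow> prob_space (M i)" and "I \<noteq> {}"
  shows "prob_space.indep_vars (Pi\<^sub>M I M) M (\<lambda>i z. z i) I"
proof -
  interpret prob_space "Pi\<^sub>M I M" using assms by (intro prob_space_PiM) auto
  have "distr (Pi\<^sub>M I M) (Pi\<^sub>M I M) (\<lambda>x. \<lambda>i\<in>I. x i) = distr (Pi\<^sub>M I M) (Pi\<^sub>M I M) (\<lambda>x. x)"
    by (intro distr_cong) (auto simp: space_PiM PiE_restrict)
  also have "\<dots> = (\<Pi>\<^sub>M i\<in>I. distr (Pi\<^sub>M I M) (M i) (\<lambda>z. z i))"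
    using assms by (auto intro!: PiM_cong simp: distr_id2 distr_PiM_component)
  finally show ?thesis
    using assms by (subst indep_vars_iff_distr_eq_PiM') auto
qed

lemma AE_gaussian_sample_variance:
  assumes v: "0 < v"
  shows "AE z in infinite_power (gaussian m v).
    (\<lambda>n. (\<Sum>k<n. (z k - m)\<^sup>2) / real n) \<longlonglongrightarrow> v"
proof -
  let ?G = "gaussian m v" and ?P = "Pi\<^sub>M UNIV (\<lambda>_::nat. gaussian m v)"
  interpret G: real_distribution ?G
    using v by (rule real_distribution_gaussian)
  interpret P: prob_space ?P by (intro prob_space_PiM) unfold_locales
  have comp: "distr ?P ?G (\<lambda>z. z k) = ?G" for k
    using distr_PiM_component[of UNIV "\<lambda>_. ?G" k] G.prob_space_axioms by simp
  have [measurable]: "(\<lambda>z. z k) \<in> measurable ?P ?G" for k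
    by simp
  \<comment> \<open>Since each coordinate has law \<open>?G\<close>, moments under the product
    measure reduce to one-dimensional ones, and the fourth moment is the same for all k.\<close>
  have intg: "integral\<^sup>L ?P (\<lambda>z. f (z k)) = integral\<^sup>L ?G f"
    if "f \<in> borel_measurable borel" for f :: "real \<Rightarrow> real" and k
    using that integral_distr[of "\<lambda>z. z k" ?P ?G f] unfolding comp by simp
  have intb: "integrable ?P (\<lambda>z. f (z k)) = integrable ?G f"
    if "f \<in> borel_measurable borel" for f :: "real \<Rightarrow> real" and k
    using that integrable_distr_eq[of "\<lambda>z. z k" ?P ?G f] unfolding comp by simp
  have "P.indep_vars (\<lambda>_. ?G) (\<lambda>k z. z k) UNIV"
    by (intro indep_vars_PiM_coordinates) (auto intro: G.prob_space_axioms)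
  then have "P.indep_vars (\<lambda>_. borel) (\<lambda>k z. (z k - m)\<^sup>2 - v) UNIV"
    by (rule P.indep_vars_compose2) simp
  then have "AE z in ?P. (\<lambda>n. (\<Sum>k<n. (z k - m)\<^sup>2 - v) / real n) \<longlonglongrightarrow> 0"
  proof (rule P.strong_law_of_large_numbers_power4)
    fix k
    show "integral\<^sup>L ?P (\<lambda>z. (z k - m)\<^sup>2 - v) = 0"
      using intg[of "\<lambda>x. (x - m)\<^sup>2 - v"] gaussian_square_moments(1)[OF v] by simp
    show "integrable ?P (\<lambda>z. ((z k - m)\<^sup>2 - v) ^ 4)"
      using intb[of "\<lambda>x. ((x - m)\<^sup>2 - v) ^ 4"] gaussian_square_moments(2)[OF v] by simp
    show "integral\<^sup>L ?P (\<lambda>z. ((z k - m)\<^sup>2 - v) ^ 4) \<le> integral\<^sup>L ?G (\<lambda>x. ((x - m)\<^sup>2 - v) ^ 4)"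
      using intg[of "\<lambda>x. ((x - m)\<^sup>2 - v) ^ 4"] by simp
  qed
  then show ?thesis
    unfolding infinite_power_def
  proof eventually_elim
    case (elim z)
    \<comment> \<open>Averaging the constant \<open>v\<close> returns \<open>v\<close> only for n >
      0; at n = 0 the quotients are 0, so the equality is only eventual.\<close>
    have "\<forall>\<^sub>F n in sequentially. (\<Sum>k<n. (z k - m)\<^sup>2 - v) / real n + v = (\<Sum>k<n. (z k - m)\<^sup>2) / real n"
      using eventually_gt_at_top[of 0] by eventually_elim (simp add: sum_subtractf field_simps)
    from Lim_transform_eventually[OF tendsto_add[OF elim tendsto_const] this] show ?case by simp
  qed
qed

section \<open>Consistency of the lower and upper limits of the volatility estimators\<close>

theorem theorem3p4p1:
  fixes t x0 \<mu> \<theta> :: real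
  assumes "t > 0" and "\<theta> > 0"
  shows "infinite_sample_consistent {0<..} (ou_law t x0 \<mu> \<theta>) (vol_estimator_liminf t x0 \<mu> \<theta>) \<and>
         infinite_sample_consistent {0<..} (ou_law t x0 \<mu> \<theta>) (vol_estimator_limsup t x0 \<mu> \<theta>)"
proof -
  \<comment> \<open>The variance is linear in the parameter with slope \<open>c\<close>, so the
    estimator is the mean squared deviation from the known mean, divided by
    \<open>c\<close>.\<close>
  define c where "c = (1 - exp (- 2 * \<theta> * t)) / (2 * \<theta>)"
  have c: "0 < c" using assms by (simp add: c_def)
  have var: "ou_variance t \<theta> s = s * c" for s by (simp add: ou_variance_def c_def)
  have est: "vol_estimator t x0 \<mu> \<theta> n z = (\<Sum>k<n. (z k - ou_mean t x0 \<mu> \<theta>)\<^sup>2) / real n / c" for n z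
    by (simp add: vol_estimator_def ou_mean_def c_def field_simps diff_diff_eq)
  have [measurable]: "(\<lambda>z. vol_estimator t x0 \<mu> \<theta> n z) \<in> borel_measurable borel" for n
    unfolding vol_estimator_def by measurable
  have distr: "real_distribution (ou_law t x0 \<mu> \<theta> s)" if "0 < s" for s
    unfolding ou_law_def var using that c by (intro real_distribution_gaussian) simp
  have lim: "AE z in infinite_power (ou_law t x0 \<mu> \<theta> s).
      (\<lambda>n. ereal (vol_estimator t x0 \<mu> \<theta> n z)) \<longlonglongrightarrow> ereal s" if "0 < s" for s
  proof -
    have "0 < s * c" using that c by simp
    from AE_gaussian_sample_variance[OF this, of "ou_mean t x0 \<mu> \<theta>"] show ?thesis
      unfolding ou_law_def var
    proof eventually_elim
      case (elim z)
      then have "(\<lambda>n. vol_estimator t x0 \<mu> \<theta> n z) \<longlonglongrightarrow> s * c / c"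
        unfolding est using c by (intro tendsto_divide) auto
      then show ?case using c by simp
    qed
  qed
  \<comment> \<open>Both estimators are handled at once: it suffices that a measurable
    \<open>T\<close> picks out the limit wherever the estimators converge to a real number.\<close>
  have consistent: "infinite_sample_consistent {0<..} (ou_law t x0 \<mu> \<theta>) T"
    if T [measurable]: "T \<in> borel_measurable borel"
      and eq: "\<And>z s. (\<lambda>n. ereal (vol_estimator t x0 \<mu> \<theta> n z)) \<longlonglongrightarrow> ereal s \<Longrightarrow> T z = s"
    for T
    unfolding infinite_sample_consistent_def
  proof (intro conjI ballI)
    fix s :: real assume "s \<in> {0<..}"
    then have s: "0 < s" by simp
    interpret L: real_distribution "ou_law t x0 \<mu> \<theta> s" using s by (rule distr)
    interpret P: prob_space "infinite_power (ou_law t x0 \<mu> \<theta> s)"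
      unfolding infinite_power_def by (intro prob_space_PiM) unfold_locales
    \<comment> \<open>Identifying the product sigma-algebra with the Borel one turns Borel
      measurability of \<open>T\<close> into measurability of the event
      \<open>T z = s\<close>.\<close>
    have "sets (infinite_power (ou_law t x0 \<mu> \<theta> s)) = sets (Pi\<^sub>M UNIV (\<lambda>_::nat. borel :: real measure))"
      unfolding infinite_power_def by (intro sets_PiM_cong) simp_all
    then have sets: "sets (infinite_power (ou_law t x0 \<mu> \<theta> s)) = sets borel"
      by (simp add: sets_PiM_equal_borel)
    have "AE z in infinite_power (ou_law t x0 \<mu> \<theta> s). z \<in> {z. T z = s}"
      using lim[OF s] by eventually_elim (simp add: eq)
    then show "emeasure (infinite_power (ou_law t x0 \<mu> \<theta> s)) {z. T z = s} = 1"
      by (intro P.emeasure_eq_1_AE) (simp_all add: sets)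
  qed (use distr in auto)
  show ?thesis
  proof (intro conjI consistent)
    show "vol_estimator_liminf t x0 \<mu> \<theta> \<in> borel_measurable borel"
      unfolding vol_estimator_liminf_def by measurable
    show "vol_estimator_limsup t x0 \<mu> \<theta> \<in> borel_measurable borel"
      unfolding vol_estimator_limsup_def by measurable
    fix z s assume "(\<lambda>n. ereal (vol_estimator t x0 \<mu> \<theta> n z)) \<longlonglongrightarrow> ereal s"
    \<comment> \<open>On a convergent sequence both limits equal the finite value \<open>s\<close>,
      so the default of \<open>real_of_ereal\<close> at infinity never intervenes.\<close>
    from lim_imp_Liminf[OF _ this] lim_imp_Limsup[OF _ this]
    show "vol_estimator_liminf t x0 \<mu> \<theta> z = s" "vol_estimator_limsup t x0 \<mu> \<theta> z = s"
      by (simp_all add: vol_estimator_liminf_def vol_estimator_limsup_def)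
  qed
qed

end
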